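(* Let $R$ be a commutative ring with identity (not assumed Noetherian), and let $I$ be a finitely generated ideal of $R$. Suppose that $R$ is $I$-adically complete and that the quotient ring $R/I$ is Noetherian. Then $R$ is Noetherian.
   Context: A commutative ring with identity is Noetherian if every ideal of it is finitely generated. The ring $R$ is called $I$-adically complete if the canonical map $R \to \varprojlim_{t} R/I^{t}$ to the $I$-adic completion is an isomorphism; in particular $R$ is then $I$-adically separated, i.e. $\bigcap_{t\ge 0} I^t = 0$. *)

theory Defs
  imports "HOL-Algebra.Algebra"
begin

definition finitely_generated_ideal :: "('a, 'b) ring_scheme \<Rightarrow> 'a set \<Rightarrow> bool" where
  "finitely_generated_ideal R I \<longleftrightarrow>
     ideal I R \<and> (\<exists>A \<subseteq> carrier R. finite A \<and> I = Idl\<^bsub>R\<^esub> A)"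

primrec ideal_power :: "('a, 'b) ring_scheme \<Rightarrow> 'a set \<Rightarrow> nat \<Rightarrow> 'a set" where
  "ideal_power R I 0 = carrier R"
| "ideal_power R I (Suc t) = ideal_prod R I (ideal_power R I t)"

(* The projection R/J \<rightarrow> R/K for ideals J \<subseteq> K: the coset C of J is sent to the coset K + C
   (see quot_proj_coset below). *)
definition quot_proj :: "('a, 'b) ring_scheme \<Rightarrow> 'a set \<Rightarrow> 'a set \<Rightarrow> 'a set" where
  "quot_proj R K C = K <+>\<^bsub>R\<^esub> C"

(* The inverse limit of the rings R/I^t, as the ring of compatible families of residue classes
   with componentwise operations. *)
definition adic_completion :: "('a, 'b) ring_scheme \<Rightarrow> 'a set \<Rightarrow> (nat \<Rightarrow> 'a set) ring" where
  "adic_completion R I =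
     \<lparr> carrier = {f. (\<forall>t. f t \<in> carrier (R Quot ideal_power R I t)) \<and>
                     (\<forall>s t. s \<le> t \<longrightarrow> quot_proj R (ideal_power R I s) (f t) = f s)},
       monoid.mult = (\<lambda>f g t. f t \<otimes>\<^bsub>R Quot ideal_power R I t\<^esub> g t),
       monoid.one = (\<lambda>t. \<one>\<^bsub>R Quot ideal_power R I t\<^esub>),
       ring.zero = (\<lambda>t. \<zero>\<^bsub>R Quot ideal_power R I t\<^esub>),
       ring.add = (\<lambda>f g t. f t \<oplus>\<^bsub>R Quot ideal_power R I t\<^esub> g t) \<rparr>"

definition to_adic_completion :: "('a, 'b) ring_scheme \<Rightarrow> 'a set \<Rightarrow> 'a \<Rightarrow> nat \<Rightarrow> 'a set" where
  "to_adic_completion R I a = (\<lambda>t. ideal_power R I t +>\<^bsub>R\<^esub> a)"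

definition adically_complete :: "('a, 'b) ring_scheme \<Rightarrow> 'a set \<Rightarrow> bool" where
  "adically_complete R I \<longleftrightarrow> to_adic_completion R I \<in> ring_iso R (adic_completion R I)"

lemma (in ring) ideal_power_ideal:
  assumes "ideal I R"
  shows "ideal (ideal_power R I t) R"
  by (induction t) (auto simp: oneideal ideal_prod_is_ideal assms)

lemma (in ring) ideal_power_antimono:
  assumes "ideal I R" "s \<le> t"
  shows "ideal_power R I t \<subseteq> ideal_power R I s"
  using assms(2)
proof (induction rule: dec_induct)
  case (step n)
  have "ideal_power R I (Suc n) \<subseteq> ideal_power R I n"
    using ideal_prod_inter[OF assms(1) ideal_power_ideal[OF assms(1), of n]] by simp
  with step.IH show ?case by blast
qed simp

lemma (in ring) quot_proj_coset:
  assumes "ideal J R" "ideal K R" "J \<subseteq> K" "a \<in> carrier R"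
  shows "quot_proj R K (J +> a) = K +> a"
proof -
  interpret J: ideal J R by fact
  interpret K: ideal K R by fact
  have "K <+> J = K"
  proof
    show "K <+> J \<subseteq> K"
      using assms(3) by (auto simp: set_add_def' intro: K.a_closed)
    show "K \<subseteq> K <+> J"
    proof
      fix x assume "x \<in> K"
      then have "x = x \<oplus> \<zero>" by (simp add: K.Icarr)
      with \<open>x \<in> K\<close> show "x \<in> K <+> J"
        unfolding set_add_def' using J.zero_closed by blast
    qed
  qed
  then show ?thesis
    unfolding quot_proj_def
    using a_setmult_rcos_assoc[of K J a] assms(4) J.a_subset K.a_subset by simp
qed

lemma (in ring) to_adic_completion_hom:
  assumes "ideal I R"
  shows "to_adic_completion R I \<in> ring_hom R (adic_completion R I)"
proof -
  have hom: "(+>) (ideal_power R I t) \<in> ring_hom R (R Quot ideal_power R I t)" for t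
    using ideal.rcos_ring_hom[OF ideal_power_ideal[OF assms]] .
  show ?thesis
    by (rule ring_hom_memI)
      (auto simp: to_adic_completion_def adic_completion_def
        quot_proj_coset ideal_power_ideal ideal_power_antimono assms
        ring_hom_mult[OF hom] ring_hom_add[OF hom] ring_hom_one[OF hom]
        intro: ring_hom_closed[OF hom])
qed

end

theory Submission
  imports Defs
begin

text \<open>
  For \<open>x \<in> I\<close> the map \<open>(y\<^sub>i) \<mapsto> (y\<^sub>i - x y\<^sub>i\<^sub>+\<^sub>1)\<close> is a bijection on sequences of elements of \<open>R\<close>,
  by completeness.  Suppose that all ideals containing \<open>A \<union> {x}\<close> are finitely generated, and let
  \<open>J \<supseteq> A\<close> be an ideal.  Since \<open>J + xR\<close> is finitely generated, there is a finite \<open>B \<subseteq> J\<close> with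
  \<open>J = (B) + x (J : x)\<close>, so \<open>J\<close> is finitely generated as soon as \<open>J : x\<close> is.
  For \<open>Q = (\<Union>n. J : x^n)\<close> we have \<open>Q : x = Q\<close>, hence \<open>Q = (B) + x Q\<close> for some finite \<open>B \<subseteq> Q\<close>.
  Expand \<open>y\<^sub>i = s\<^sub>i + x y\<^sub>i\<^sub>+\<^sub>1\<close> with \<open>s\<^sub>i \<in> (B)\<close> and solve \<open>s\<^sub>i = t\<^sub>i - x t\<^sub>i\<^sub>+\<^sub>1\<close> within \<open>(B)\<close>; injectivity
  gives \<open>y\<^sub>i = t\<^sub>i \<in> (B)\<close>, so \<open>Q = (B)\<close>.  Then \<open>Q = J : x^n\<close> for some \<open>n\<close>, and by descending
  induction \<open>J\<close> is finitely generated.  Starting from the ideals containing \<open>I\<close>, remove the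
  generators of \<open>I\<close> one at a time.
\<close>

section \<open>Colon ideals and the recursion attached to an element\<close>

definition ideal_colon :: "('a, 'b) ring_scheme \<Rightarrow> 'a set \<Rightarrow> 'a \<Rightarrow> 'a set" where
  "ideal_colon R J x = {r \<in> carrier R. r \<otimes>\<^bsub>R\<^esub> x \<in> J}"

text \<open>The equation says that \<open>y\<close> is a preimage of \<open>a\<close> under the map
  \<open>y i - x y (i+1)\<close>, so unique solvability is bijectivity of that map. The condition
  concerns a single element and no topology, so it can be applied separately to each generator of
  \<open>I\<close>.\<close>

definition shift_complete :: "('a, 'b) ring_scheme \<Rightarrow> 'a \<Rightarrow> bool" where
  "shift_complete R x \<longleftrightarrow>
     (\<forall>a \<in> UNIV \<rightarrow> carrier R. \<exists>!y. y \<in> UNIV \<rightarrow> carrier R \<and>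
        (\<forall>i::nat. y i = a i \<oplus>\<^bsub>R\<^esub> x \<otimes>\<^bsub>R\<^esub> y (Suc i)))"

lemma (in ring) finitely_generated_idealI:
  assumes "ideal J R" "finite A" "A \<subseteq> J" "J \<subseteq> Idl A"
  shows "finitely_generated_ideal R J"
proof -
  interpret J: ideal J R by fact
  have "J = Idl A" using assms genideal_minimal by blast
  then show ?thesis
    unfolding finitely_generated_ideal_def using assms J.a_subset by blast
qed

context cring
begin

lemma ideal_colon_ideal:
  assumes "ideal J R" "x \<in> carrier R"
  shows "ideal (ideal_colon R J x) R"
proof -
  interpret J: ideal J R by fact
  show ?thesis
  proof (rule idealI)
    show "ring R" by unfold_locales
    show "subgroup (ideal_colon R J x) (add_monoid R)"
      using assms(2)
      by (intro add.subgroupI)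
        (auto simp: ideal_colon_def l_distr l_minus intro: exI[of _ \<zero>] simp flip: a_inv_def)
    show "b \<otimes> a \<in> ideal_colon R J x" "a \<otimes> b \<in> ideal_colon R J x"
      if "a \<in> ideal_colon R J x" "b \<in> carrier R" for a b
    proof -
      have *: "a \<in> carrier R" "b \<otimes> (a \<otimes> x) \<in> J"
        using that by (auto simp: ideal_colon_def J.I_l_closed)
      then show "b \<otimes> a \<in> ideal_colon R J x"
        using that(2) assms(2) by (simp add: ideal_colon_def m_assoc)
      then show "a \<otimes> b \<in> ideal_colon R J x"
        using *(1) that(2) by (simp add: m_comm)
    qed
  qed
qed

lemma ideal_subset_colon:
  assumes "ideal J R" "x \<in> carrier R"
  shows "J \<subseteq> ideal_colon R J x"
proof -
  interpret J: ideal J R by fact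
  show ?thesis using assms(2) by (auto simp: ideal_colon_def J.I_r_closed J.Icarr)
qed

lemma ideal_colon_one:
  assumes "ideal J R"
  shows "ideal_colon R J \<one> = J"
proof -
  interpret J: ideal J R by fact
  show ?thesis by (auto simp: ideal_colon_def J.Icarr)
qed

lemma ideal_colon_colon:
  assumes "x \<in> carrier R" "y \<in> carrier R"
  shows "ideal_colon R (ideal_colon R J x) y = ideal_colon R J (y \<otimes> x)"
  using assms by (auto simp: ideal_colon_def m_assoc)

section \<open>Ideals modulo one element\<close>

lemma Idl_insert_decomp:
  assumes "B \<subseteq> carrier R" "x \<in> carrier R" "y \<in> Idl (insert x B)"
  obtains u r where "u \<in> Idl B" "r \<in> carrier R" "y = u \<oplus> r \<otimes> x"
proof -
  have "Idl (insert x B) \<subseteq> Idl (Idl B \<union> PIdl x)"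
  proof (rule subset_Idl_subset)
    show "Idl B \<union> PIdl x \<subseteq> carrier R"
      using genideal_ideal[OF assms(1)] cgenideal_ideal[OF assms(2)]
      by (auto dest: ideal.Icarr)
    show "insert x B \<subseteq> Idl B \<union> PIdl x"
      using genideal_self[OF assms(1)] cgenideal_self[OF assms(2)] by blast
  qed
  also have "\<dots> = Idl B <+> PIdl x"
    by (intro union_genideal genideal_ideal cgenideal_ideal assms)
  finally show thesis
    using assms(3) that by (auto simp: set_add_def' cgenideal_def)
qed

text \<open>Finitely many generators of \<open>J + xR\<close> have the form \<open>u + r x\<close>
  with \<open>u\<close> in \<open>J\<close>; these \<open>u\<close> form \<open>B\<close>, and
  \<open>J + xR = (B) + xR\<close>. If \<open>y = v + s x\<close> with \<open>y\<close> in
  \<open>J\<close> and \<open>v\<close> in \<open>(B)\<close>, then \<open>s x\<close> lies in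
  \<open>J\<close>, which puts the coefficient \<open>s\<close> into the colon ideal.\<close>

lemma decomp_mod_element:
  assumes "ideal J R" "x \<in> carrier R"
    and fg: "finitely_generated_ideal R (Idl (insert x J))"
  obtains B where "finite B" "B \<subseteq> J"
    "\<And>y. y \<in> J \<Longrightarrow> \<exists>u \<in> Idl B. \<exists>r \<in> ideal_colon R J x. y = u \<oplus> r \<otimes> x"
proof -
  interpret J: ideal J R by fact
  have J_sub: "J \<subseteq> carrier R" by (rule J.a_subset)
  have Idl_J: "Idl J = J"
    using genideal_minimal[OF assms(1)] genideal_self[OF J_sub] by blast
  obtain C where C: "finite C" "C \<subseteq> carrier R" "Idl (insert x J) = Idl C"
    using fg unfolding finitely_generated_ideal_def by blast
  have "\<exists>u \<in> J. \<exists>r \<in> carrier R. c = u \<oplus> r \<otimes> x" if "c \<in> C" for c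
  proof -
    have "c \<in> Idl (insert x J)" using that C genideal_self by blast
    then show ?thesis
      using Idl_insert_decomp[OF J_sub assms(2)] Idl_J by metis
  qed
  then obtain u r where ur: "\<And>c. c \<in> C \<Longrightarrow> u c \<in> J \<and> r c \<in> carrier R \<and> c = u c \<oplus> r c \<otimes> x"
    by metis
  define B where "B = u ` C"
  have B: "finite B" "B \<subseteq> J" using C ur by (auto simp: B_def)
  with J_sub have B_sub: "B \<subseteq> carrier R" by blast
  have xB_sub: "insert x B \<subseteq> carrier R" using B_sub assms(2) by blast
  interpret K: ideal "Idl (insert x B)" R by (rule genideal_ideal[OF xB_sub])
  have "C \<subseteq> Idl (insert x B)"
  proof
    fix c assume "c \<in> C"
    moreover have "x \<in> Idl (insert x B)" "B \<subseteq> Idl (insert x B)"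
      using genideal_self[OF xB_sub] by auto
    ultimately have "u c \<oplus> r c \<otimes> x \<in> Idl (insert x B)"
      using ur by (intro K.a_closed K.I_l_closed) (auto simp: B_def)
    with ur \<open>c \<in> C\<close> show "c \<in> Idl (insert x B)" by simp
  qed
  then have sub: "Idl (insert x J) \<subseteq> Idl (insert x B)"
    using C(3) genideal_minimal[OF K.ideal_axioms] by simp
  show thesis
  proof
    fix y assume y: "y \<in> J"
    then have "y \<in> Idl (insert x B)"
      using sub genideal_self[of "insert x J"] J_sub assms(2) by blast
    then obtain v s where vs: "v \<in> Idl B" "s \<in> carrier R" "y = v \<oplus> s \<otimes> x"
      using Idl_insert_decomp[OF B_sub assms(2)] by metis
    have v: "v \<in> J" using vs(1) B(2) genideal_minimal[OF assms(1)] by blast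
    have "s \<otimes> x = \<ominus> v \<oplus> y"
      using vs v assms(2) J.Icarr by (simp add: r_neg1)
    also have "\<dots> \<in> J" using v y by simp
    finally have "s \<in> ideal_colon R J x" using vs(2) by (simp add: ideal_colon_def)
    with vs show "\<exists>u \<in> Idl B. \<exists>r \<in> ideal_colon R J x. y = u \<oplus> r \<otimes> x" by blast
  qed (use B in auto)
qed

text \<open>The set \<open>B\<close> from the decomposition, together with the products
  \<open>d x\<close> for generators \<open>d\<close> of \<open>J : x\<close>, generates
  \<open>J\<close>.\<close>

lemma finitely_generated_of_colon:
  assumes J: "ideal J R" and x: "x \<in> carrier R"
    and fg: "finitely_generated_ideal R (Idl (insert x J))"
    and fg_colon: "finitely_generated_ideal R (ideal_colon R J x)"
  shows "finitely_generated_ideal R J"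
proof -
  interpret J: ideal J R by fact
  obtain B where B: "finite B" "B \<subseteq> J"
    "\<And>y. y \<in> J \<Longrightarrow> \<exists>u \<in> Idl B. \<exists>r \<in> ideal_colon R J x. y = u \<oplus> r \<otimes> x"
    using decomp_mod_element[OF J x fg] by blast
  obtain D where D: "finite D" "D \<subseteq> carrier R" "ideal_colon R J x = Idl D"
    using fg_colon unfolding finitely_generated_ideal_def by blast
  define E where "E = B \<union> (\<lambda>d. d \<otimes> x) ` D"
  have "(\<lambda>d. d \<otimes> x) ` D \<subseteq> J"
    using D genideal_self[OF D(2)] by (auto simp: ideal_colon_def)
  then have E: "finite E" "E \<subseteq> J" using B D by (auto simp: E_def)
  then have E_sub: "E \<subseteq> carrier R" using J.a_subset by blast
  interpret K: ideal "Idl E" R by (rule genideal_ideal[OF E_sub])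
  \<comment> \<open>Since \<open>(E) : x\<close> is itself an ideal, it contains
    \<open>J : x\<close> as soon as it contains the generators \<open>D\<close>.\<close>
  have "D \<subseteq> ideal_colon R (Idl E) x"
    using D(2) genideal_self[OF E_sub] by (auto simp: ideal_colon_def E_def)
  then have colon_sub: "ideal_colon R J x \<subseteq> ideal_colon R (Idl E) x"
    unfolding D(3) by (rule genideal_minimal[OF ideal_colon_ideal[OF K.ideal_axioms x]])
  have B_sub: "Idl B \<subseteq> Idl E"
    using subset_Idl_subset[OF E_sub] genideal_self[OF E_sub] by (simp add: E_def)
  have "J \<subseteq> Idl E"
  proof
    fix y assume "y \<in> J"
    then obtain u r where "u \<in> Idl B" "r \<in> ideal_colon R J x" "y = u \<oplus> r \<otimes> x"
      using B(3) by blast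
    with colon_sub B_sub show "y \<in> Idl E"
      by (auto simp: ideal_colon_def intro!: K.a_closed)
  qed
  with E show ?thesis by (intro finitely_generated_idealI[OF J])
qed

section \<open>Recursions inside a finitely generated ideal\<close>

text \<open>Each generator in \<open>B\<close> gets its own sequence of coefficients in
  \<open>R\<close>. The recursion is solved for these coefficients, and linearity recombines the
  solutions to one with values in \<open>(B)\<close>. No closedness of \<open>(B)\<close> in the
  adic topology is invoked.\<close>

lemma shift_complete_solution_in_Idl:
  assumes x: "x \<in> carrier R" and sc: "shift_complete R x"
    and "finite B" "B \<subseteq> carrier R" "s \<in> UNIV \<rightarrow> Idl B"
  shows "\<exists>t \<in> UNIV \<rightarrow> Idl B. \<forall>i. t i = s i \<oplus> x \<otimes> t (Suc i)"
  using assms(3-5)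
proof (induction B arbitrary: s rule: finite_induct)
  case empty
  have "Idl {} = {\<zero>}"
    using genideal_minimal[OF zeroideal, of "{}"] additive_subgroup.zero_closed[of "Idl {}" R]
      genideal_ideal[of "{}"] by (auto dest: ideal.axioms(1))
  moreover from this have "s i = \<zero>" for i using empty.prems(2) by auto
  ultimately show ?case
    using x by (intro bexI[of _ "\<lambda>_. \<zero>"]) auto
next
  case (insert b B)
  have b: "b \<in> carrier R" and B: "B \<subseteq> carrier R" using insert.prems by auto
  have "\<forall>i. \<exists>u r. u \<in> Idl B \<and> r \<in> carrier R \<and> s i = u \<oplus> r \<otimes> b"
    using Idl_insert_decomp[OF B b] insert.prems(2) by (metis PiE UNIV_I)
  then obtain u r where ur: "\<And>i. u i \<in> Idl B" "\<And>i. r i \<in> carrier R"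
      "\<And>i. s i = u i \<oplus> r i \<otimes> b"
    by metis
  obtain t where t: "t \<in> UNIV \<rightarrow> Idl B" "\<And>i. t i = u i \<oplus> x \<otimes> t (Suc i)"
    using insert.IH[of u] B ur by blast
  \<comment> \<open>Existence in \<open>shift_complete\<close> is applied to the coefficients
    \<open>r\<close> of the new generator \<open>b\<close>.\<close>
  obtain z where z: "\<And>i. z i \<in> carrier R" "\<And>i. z i = r i \<oplus> x \<otimes> z (Suc i)"
  proof -
    have "r \<in> UNIV \<rightarrow> carrier R" using ur(2) by simp
    from sc[unfolded shift_complete_def, rule_format, OF this]
    obtain z where z: "z \<in> UNIV \<rightarrow> carrier R" "\<forall>i. z i = r i \<oplus> x \<otimes> z (Suc i)"
      by (elim ex1E conjE)
    show thesis by (rule that[OF funcset_mem[OF z(1) UNIV_I] spec[OF z(2)]])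
  qed
  have B_carr: "v \<in> carrier R" if "v \<in> Idl B" for v
    using ideal.Icarr[OF genideal_ideal[OF B] that] .
  interpret K: ideal "Idl (insert b B)" R by (rule genideal_ideal[OF insert.prems(1)])
  have K: "b \<in> Idl (insert b B)" "Idl B \<subseteq> Idl (insert b B)"
    using genideal_self[OF insert.prems(1)] subset_Idl_subset[OF insert.prems(1)] by auto
  show ?case
  proof (intro bexI allI)
    show "(\<lambda>i. t i \<oplus> z i \<otimes> b) \<in> UNIV \<rightarrow> Idl (insert b B)"
      using t(1) z(1) K by (auto intro!: K.a_closed K.I_l_closed)
    fix i
    have carr: "u i \<in> carrier R" "t (Suc i) \<in> carrier R" using ur(1) t(1) B_carr by auto
    have "t i \<oplus> z i \<otimes> b = (u i \<oplus> x \<otimes> t (Suc i)) \<oplus> (r i \<oplus> x \<otimes> z (Suc i)) \<otimes> b"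
      using t(2)[of i] z(2)[of i] by simp
    also have "\<dots> = (u i \<oplus> r i \<otimes> b) \<oplus> x \<otimes> (t (Suc i) \<oplus> z (Suc i) \<otimes> b)"
      using carr ur(2)[of i] z(1)[of "Suc i"] x b by algebra
    finally show "t i \<oplus> z i \<otimes> b = s i \<oplus> x \<otimes> (t (Suc i) \<oplus> z (Suc i) \<otimes> b)"
      using ur(3) by simp
  qed
qed

lemma finitely_generated_of_colon_fixed:
  assumes Q: "ideal Q R" and x: "x \<in> carrier R" and sc: "shift_complete R x"
    and fg: "finitely_generated_ideal R (Idl (insert x Q))"
    and colon: "ideal_colon R Q x = Q"
  shows "finitely_generated_ideal R Q"
proof -
  interpret Q: ideal Q R by fact
  obtain B where B: "finite B" "B \<subseteq> Q"
    "\<And>y. y \<in> Q \<Longrightarrow> \<exists>u \<in> Idl B. \<exists>r \<in> Q. y = u \<oplus> r \<otimes> x"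
    using decomp_mod_element[OF Q x fg] unfolding colon by blast
  then have B_sub: "B \<subseteq> carrier R" using Q.a_subset by blast
  obtain u g where ug: "\<And>y. y \<in> Q \<Longrightarrow> u y \<in> Idl B \<and> g y \<in> Q \<and> y = u y \<oplus> g y \<otimes> x"
    using B(3) by metis
  have B_carr: "v \<in> carrier R" if "v \<in> Idl B" for v
    using ideal.Icarr[OF genideal_ideal[OF B_sub] that] .
  have "Q \<subseteq> Idl B"
  proof
    fix y0 assume y0: "y0 \<in> Q"
    \<comment> \<open>Iterating \<open>g\<close>, the choice of a coefficient in \<open>Q\<close>,
      stays in \<open>Q\<close> because \<open>Q : x = Q\<close>, so the expansion of
      \<open>y0\<close> never stops.\<close>
    define y where "y i = (g ^^ i) y0" for i
    have y: "y i \<in> Q" for i by (induction i) (auto simp: y_def y0 ug)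
    have y_carr: "y i \<in> carrier R" for i using y by (rule Q.Icarr)
    have y_eq: "y i = u (y i) \<oplus> x \<otimes> y (Suc i)" for i
    proof -
      have "y (Suc i) = g (y i)" by (simp add: y_def)
      then show ?thesis using ug[OF y[of i]] y_carr[of "Suc i"] x by (metis m_comm)
    qed
    have "(\<lambda>i. u (y i)) \<in> UNIV \<rightarrow> Idl B" using ug y by simp
    from shift_complete_solution_in_Idl[OF x sc B(1) B_sub this]
    obtain t where t: "t \<in> UNIV \<rightarrow> Idl B" "\<forall>i. t i = u (y i) \<oplus> x \<otimes> t (Suc i)"
      by (elim bexE)
    have "(\<lambda>i. u (y i)) \<in> UNIV \<rightarrow> carrier R" using ug y B_carr by simp
    with sc have "\<exists>!y'. y' \<in> UNIV \<rightarrow> carrier R \<and> (\<forall>i. y' i = u (y i) \<oplus> x \<otimes> y' (Suc i))"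
      unfolding shift_complete_def by (rule bspec)
    \<comment> \<open>Both \<open>y\<close> and the solution \<open>t\<close> with values in
      \<open>(B)\<close> solve the same recursion, so uniqueness identifies them.\<close>
    then obtain w where uniq:
      "\<forall>v. v \<in> UNIV \<rightarrow> carrier R \<and> (\<forall>i. v i = u (y i) \<oplus> x \<otimes> v (Suc i)) \<longrightarrow> v = w"
      by (rule ex1E)
    have w: "v = w"
      if "v \<in> UNIV \<rightarrow> carrier R" "\<forall>i. v i = u (y i) \<oplus> x \<otimes> v (Suc i)" for v
      by (rule mp[OF spec[OF uniq] conjI[OF that]])
    have "y = w" using y_carr by (intro w allI y_eq) simp
    moreover have "t = w" using t B_carr by (intro w) blast+
    ultimately have "y = t" by simp
    then have "y 0 \<in> Idl B" using t(1) by blast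
    then show "y0 \<in> Idl B" by (simp add: y_def)
  qed
  with B show ?thesis by (intro finitely_generated_idealI[OF Q])
qed

section \<open>Removing generators one at a time\<close>

text \<open>Stabilization of the increasing chain \<open>J : x^n\<close> is not known beforehand; it
  results from finite generation of its union.\<close>

lemma finitely_generated_drop_element:
  assumes x: "x \<in> carrier R" and sc: "shift_complete R x"
    and fg: "\<And>J. ideal J R \<Longrightarrow> insert x A \<subseteq> J \<Longrightarrow> finitely_generated_ideal R J"
    and J: "ideal J R" "A \<subseteq> J"
  shows "finitely_generated_ideal R J"
proof -
  define C where "C n = ideal_colon R J (x [^] n)" for n :: nat
  have C_ideal: "ideal (C n) R" for n
    unfolding C_def using J(1) x by (intro ideal_colon_ideal) auto
  have C_colon: "ideal_colon R (C n) x = C (Suc n)" for n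
    unfolding C_def using x by (simp add: ideal_colon_colon m_comm)
  have C_mono: "C m \<subseteq> C n" if "m \<le> n" for m n
    using that
  proof (rule lift_Suc_mono_le[rotated])
    show "C n \<subseteq> C (Suc n)" for n
      using ideal_subset_colon[OF C_ideal x] C_colon by simp
  qed
  have C_0: "C 0 = J" using ideal_colon_one[OF J(1)] by (simp add: C_def)
  have fg_insert: "finitely_generated_ideal R (Idl (insert x K))"
    if "ideal K R" "J \<subseteq> K" for K
  proof -
    interpret K: ideal K R by fact
    have *: "insert x K \<subseteq> carrier R" using x K.a_subset by blast
    then show ?thesis
      using genideal_self[OF *] that(2) J(2) by (intro fg genideal_ideal) auto
  qed
  define Q where "Q = (\<Union>n. C n)"
  have Q_ideal: "ideal Q R"
  proof (rule idealI)
    show "ring R" by unfold_locales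
    show "subgroup Q (add_monoid R)"
    proof (intro add.subgroupI)
      show "Q \<subseteq> carrier R" using C_ideal by (auto simp: Q_def dest: ideal.Icarr)
      show "Q \<noteq> {}"
        using additive_subgroup.zero_closed[OF ideal.axioms(1)[OF C_ideal[of 0]]]
        by (auto simp: Q_def)
      fix a assume "a \<in> Q"
      then show "\<ominus> a \<in> Q"
        using additive_subgroup.a_inv_closed[OF ideal.axioms(1)[OF C_ideal]]
        by (auto simp: Q_def)
      fix b assume "b \<in> Q"
      with \<open>a \<in> Q\<close> obtain m n where "a \<in> C m" "b \<in> C n" by (auto simp: Q_def)
      then have "a \<in> C (max m n)" "b \<in> C (max m n)"
        using C_mono[of m "max m n"] C_mono[of n "max m n"] by auto
      then show "a \<oplus> b \<in> Q"
        using additive_subgroup.a_closed[OF ideal.axioms(1)[OF C_ideal]]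
        by (auto simp: Q_def)
    qed
  qed (use C_ideal in \<open>auto simp: Q_def intro: ideal.I_l_closed ideal.I_r_closed\<close>)
  \<comment> \<open>The colon by \<open>x\<close> commutes with the union and shifts the chain by
    one index, which leaves the union unchanged.\<close>
  have "ideal_colon R Q x = (\<Union>n. ideal_colon R (C n) x)"
    by (auto simp: Q_def ideal_colon_def)
  also have "\<dots> = Q"
    using C_mono[OF le_SucI[OF le_refl]] by (auto simp: Q_def C_colon)
  finally have Q_colon: "ideal_colon R Q x = Q" .
  have "J \<subseteq> Q" using C_0 by (auto simp: Q_def)
  then have "finitely_generated_ideal R Q"
    by (intro finitely_generated_of_colon_fixed[OF Q_ideal x sc _ Q_colon] fg_insert Q_ideal)
  then obtain D where D: "finite D" "D \<subseteq> carrier R" "Q = Idl D"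
    unfolding finitely_generated_ideal_def by blast
  have "\<forall>d \<in> D. \<exists>n. d \<in> C n" using genideal_self[OF D(2)] D(3) by (auto simp: Q_def)
  then obtain k where k: "\<And>d. d \<in> D \<Longrightarrow> d \<in> C (k d)" by metis
  \<comment> \<open>\<open>k d\<close> is a stage at which the generator \<open>d\<close> is
    present; a common bound \<open>N\<close> yields one stage containing all of
    \<open>D\<close>.\<close>
  obtain N where N: "\<And>d. d \<in> D \<Longrightarrow> k d \<le> N"
    using D(1) finite_nat_set_iff_bounded_le[of "k ` D"] by auto
  have "D \<subseteq> C N" using k C_mono[OF N] by blast
  then have "Q \<subseteq> C N" unfolding D(3) by (rule genideal_minimal[OF C_ideal])
  then have "C N = Q" by (auto simp: Q_def)
  then have base: "finitely_generated_ideal R (C N)"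
    using \<open>finitely_generated_ideal R Q\<close> by simp
  \<comment> \<open>Downward from \<open>N\<close>: \<open>C n : x = C (Suc n)\<close> is finitely
    generated, and \<open>C n\<close> contains \<open>J\<close>, so \<open>fg_insert\<close> applies
    to it.\<close>
  have "finitely_generated_ideal R (C 0)"
    using le0[of N] base
  proof (induction rule: inc_induct)
    case (step n)
    then show ?case
      using C_0 C_mono[of 0 n]
      by (intro finitely_generated_of_colon[OF C_ideal x] fg_insert C_ideal)
        (auto simp: C_colon)
  qed
  then show ?thesis by (simp add: C_0)
qed

text \<open>Once every element of \<open>A\<close> has been removed, the containment condition is
  empty and all ideals are covered.\<close>

lemma finitely_generated_drop_finite:
  assumes "finite A"
    and "\<And>x. x \<in> A \<Longrightarrow> x \<in> carrier R" "\<And>x. x \<in> A \<Longrightarrow> shift_complete R x"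
    and "\<And>J. ideal J R \<Longrightarrow> A \<subseteq> J \<Longrightarrow> finitely_generated_ideal R J"
    and "ideal J R"
  shows "finitely_generated_ideal R J"
  using assms
proof (induction A arbitrary: J rule: finite_induct)
  case (insert x A)
  show ?case
  proof (rule insert.IH)
    show "finitely_generated_ideal R K" if "ideal K R" "A \<subseteq> K" for K
    proof (rule finitely_generated_drop_element[where x = x and A = A])
    qed (use insert.prems that in simp_all)
  qed (use insert.prems in auto)
qed blast

section \<open>Ideals containing \<open>I\<close>\<close>

text \<open>Generators of \<open>I\<close> together with lifts to \<open>J\<close> of generators of
  \<open>J/I\<close> generate \<open>J\<close>.\<close>

lemma finitely_generated_of_quotient:
  assumes I: "finitely_generated_ideal R I"
    and noeth: "noetherian_ring (R Quot I)"
    and J: "ideal J R" "I \<subseteq> J"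
  shows "finitely_generated_ideal R J"
proof -
  obtain A where A: "ideal I R" "finite A" "A \<subseteq> carrier R" "I = Idl A"
    using I unfolding finitely_generated_ideal_def by blast
  interpret I: ideal I R by fact
  interpret J: ideal J R by fact
  interpret N: noetherian_ring "R Quot I" by fact
  have J_img: "ideal ((+>) I ` J) (R Quot I)"
    by (rule ring_ideal_imp_quot_ideal[OF A(1) J(1)])
  then obtain C where C: "C \<subseteq> carrier (R Quot I)" "finite C"
      "(+>) I ` J = Idl\<^bsub>R Quot I\<^esub> C"
    using N.finetely_gen[OF J_img] by metis
  then have "C \<subseteq> (+>) I ` J" using N.genideal_self by blast
  then obtain B where B: "B \<subseteq> J" "finite B" "C = (+>) I ` B"
    using C(2) finite_subset_image by metis
  define L where "L = Idl (B \<union> A)"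
  have AJ: "A \<subseteq> J" using A J(2) genideal_self by blast
  then have BA: "B \<union> A \<subseteq> carrier R" using B J.a_subset by blast
  have L: "ideal L R" "B \<union> A \<subseteq> L"
    unfolding L_def using genideal_ideal genideal_self BA by blast+
  have "I \<subseteq> L" using A(4) L genideal_minimal by blast
  have "L \<subseteq> J" unfolding L_def using B AJ by (intro genideal_minimal J) auto
  have "Idl\<^bsub>R Quot I\<^esub> C \<subseteq> (+>) I ` L"
    using L B by (intro N.genideal_minimal ring_ideal_imp_quot_ideal A) auto
  then have "(+>) I ` J = (+>) I ` L" using C(3) \<open>L \<subseteq> J\<close> by blast
  \<comment> \<open>Both ideals contain \<open>I\<close> and have the same image in
    \<open>R/I\<close>, so the ideal correspondence makes them equal.\<close>
  then have "J = L"
    using bij_betw_imp_inj_on[OF quot_ideal_correspondence[OF A(1)]] J L \<open>I \<subseteq> L\<close>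
    by (auto simp: inj_on_def)
  then show ?thesis
    using A(2) B AJ by (intro finitely_generated_idealI[OF J(1), of "B \<union> A"]) (auto simp: L_def)
qed

section \<open>Limits in an adically complete ring\<close>

text \<open>Such a \<open>d\<close> has the same image as zero in the completion, and the canonical
  map is injective.\<close>

lemma adically_complete_separated:
  assumes I: "ideal I R" and complete: "adically_complete R I"
    and d: "d \<in> carrier R" "\<And>t. d \<in> ideal_power R I t"
  shows "d = \<zero>"
proof -
  have "inj_on (to_adic_completion R I) (carrier R)"
    using complete by (simp add: adically_complete_def ring_iso_def bij_betw_def)
  moreover have "to_adic_completion R I d = to_adic_completion R I \<zero>"
    unfolding to_adic_completion_def
  proof
    fix t
    show "ideal_power R I t +> d = ideal_power R I t +> \<zero>"
      using quotient_eq_iff_same_a_r_cos[OF ideal_power_ideal[OF I, of t] d(1) zero_closed] d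
      by (simp add: a_minus_def)
  qed
  ultimately show ?thesis using d(1) by (auto simp: inj_on_def)
qed

text \<open>The residue classes of \<open>s t\<close> modulo \<open>I^t\<close> form a compatible
  family; surjectivity of the canonical map provides \<open>y\<close>.\<close>

lemma adically_complete_limit:
  assumes I: "ideal I R" and complete: "adically_complete R I"
    and s: "\<And>t. s t \<in> carrier R" "\<And>t. s (Suc t) \<ominus> s t \<in> ideal_power R I t"
  obtains y where "y \<in> carrier R" "\<And>t. y \<ominus> s t \<in> ideal_power R I t"
proof -
  define f where "f t = ideal_power R I t +> s t" for t
  note P = ideal_power_ideal[OF I]
  note eq = quotient_eq_iff_same_a_r_cos[OF P]
  have coset: "ideal_power R I m +> s t = ideal_power R I m +> s m" if "m \<le> t" for m t
    using that
  proof (induction rule: dec_induct)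
    case (step n)
    have "s (Suc n) \<ominus> s n \<in> ideal_power R I m"
      using s(2)[of n] ideal_power_antimono[OF I step.hyps(1)] by blast
    with step.IH show ?case using eq[OF s(1) s(1)] by metis
  qed simp
  have "f t \<in> carrier (R Quot ideal_power R I t)" for t
    unfolding f_def by (rule ring_hom_closed[OF ideal.rcos_ring_hom[OF P] s(1)])
  moreover have "quot_proj R (ideal_power R I m) (f t) = f m" if "m \<le> t" for m t
    unfolding f_def
    using quot_proj_coset[OF P P ideal_power_antimono[OF I that] s(1)] coset[OF that] by simp
  ultimately have "f \<in> carrier (adic_completion R I)"
    by (simp add: adic_completion_def)
  moreover have "to_adic_completion R I ` carrier R = carrier (adic_completion R I)"
    using complete by (simp add: adically_complete_def ring_iso_def bij_betw_def)
  ultimately obtain y where y: "y \<in> carrier R" "to_adic_completion R I y = f"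
    by (metis imageE)
  have "ideal_power R I t +> y = ideal_power R I t +> s t" for t
    using y(2) by (auto simp: f_def to_adic_completion_def fun_eq_iff)
  then show thesis using that y(1) eq[OF y(1) s(1)] by blast
qed

text \<open>The solution is the convergent series
  \<open>y k = a k + x a (k+1) + x^2 a (k+2) + ...\<close>. For uniqueness, the differences of two
  solutions satisfy \<open>d i = x d (i+1)\<close>, so they lie in every \<open>I^t\<close> and
  vanish by separatedness.\<close>

lemma adically_complete_imp_shift_complete:
  assumes I: "ideal I R" and complete: "adically_complete R I" and xI: "x \<in> I"
  shows "shift_complete R x"
  unfolding shift_complete_def
proof (intro ballI ex_ex1I)
  interpret I: ideal I R by fact
  have x: "x \<in> carrier R" using xI by (rule I.Icarr)
  note P = ideal_power_ideal[OF I]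
  have P_mult: "x \<otimes> v \<in> ideal_power R I (Suc t)" if "v \<in> ideal_power R I t" for v t
    using that xI by (auto intro: ideal_prod.prod)
  have P_add: "v \<oplus> w \<in> ideal_power R I t"
    if "v \<in> ideal_power R I t" "w \<in> ideal_power R I t" for v w t
    using that additive_subgroup.a_closed[OF ideal.axioms(1)[OF P]] by blast
  have P_minus: "\<ominus> v \<in> ideal_power R I t" if "v \<in> ideal_power R I t" for v t
    using that additive_subgroup.a_inv_closed[OF ideal.axioms(1)[OF P]] by blast
  fix a :: "nat \<Rightarrow> 'a" assume a: "a \<in> UNIV \<rightarrow> carrier R"
  have a_carr: "a i \<in> carrier R" for i using a by blast
  \<comment> \<open>\<open>s t k\<close> is the partial sum \<open>\<Sum>i<t. x^i a\<^bsub>k+i\<^esub>\<close> in Horner form.\<close>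
  define s where "s = rec_nat (\<lambda>_. \<zero>) (\<lambda>_ f k. a k \<oplus> x \<otimes> f (Suc k))"
  have s_0: "s 0 k = \<zero>" and s_Suc: "s (Suc t) k = a k \<oplus> x \<otimes> s t (Suc k)" for t k
    by (simp_all add: s_def)
  have s_carr: "s t k \<in> carrier R" for t k
    by (induction t arbitrary: k) (auto simp: s_0 s_Suc a_carr x)
  \<comment> \<open>The difference is \<open>x^t a (k+t)\<close>. Since the Horner form advances
    \<open>k\<close>, the induction needs \<open>k\<close> arbitrary.\<close>
  have s_diff: "s (Suc t) k \<ominus> s t k \<in> ideal_power R I t" for t k
  proof (induction t arbitrary: k)
    case 0
    then show ?case using s_carr by simp
  next
    case (Suc t)
    have "s (Suc (Suc t)) k \<ominus> s (Suc t) k = x \<otimes> (s (Suc t) (Suc k) \<ominus> s t (Suc k))"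
      unfolding s_Suc[of "Suc t" k] s_Suc[of t k]
      using a_carr[of k] s_carr[of "Suc t" "Suc k"] s_carr[of t "Suc k"] x by algebra
    then show ?case using P_mult[OF Suc.IH] by metis
  qed
  have "\<exists>y \<in> carrier R. \<forall>t. y \<ominus> s t k \<in> ideal_power R I t" for k
    using adically_complete_limit[OF I complete, of "\<lambda>t. s t k"] s_carr s_diff by metis
  then obtain y where y: "\<And>k. y k \<in> carrier R" "\<And>k t. y k \<ominus> s t k \<in> ideal_power R I t"
    by metis
  have "y k = a k \<oplus> x \<otimes> y (Suc k)" for k
  proof -
    define d where "d = y k \<ominus> (a k \<oplus> x \<otimes> y (Suc k))"
    have d: "d \<in> carrier R" using y(1) a_carr x by (simp add: d_def)
    have "d \<in> ideal_power R I t" for t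
    proof -
      \<comment> \<open>The truncation \<open>Suc t\<close> at \<open>k\<close> matches the
        truncation \<open>t\<close> at \<open>Suc k\<close>; the factor \<open>x\<close> makes up
        the missing power, so both terms lie in \<open>I^(t+1)\<close>.\<close>
      have "d = (y k \<ominus> s (Suc t) k) \<oplus> \<ominus> (x \<otimes> (y (Suc k) \<ominus> s t (Suc k)))"
        unfolding d_def s_Suc
        using y(1)[of k] y(1)[of "Suc k"] a_carr[of k] s_carr[of t "Suc k"] x by algebra
      also have "\<dots> \<in> ideal_power R I (Suc t)"
        using y(2) P_mult by (intro P_add P_minus) blast+
      finally show ?thesis using ideal_power_antimono[OF I, of t "Suc t"] by auto
    qed
    then have "d = \<zero>" by (rule adically_complete_separated[OF I complete d])
    then show ?thesis using y(1) a_carr x by (simp add: d_def)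
  qed
  then show "\<exists>y. y \<in> UNIV \<rightarrow> carrier R \<and> (\<forall>i. y i = a i \<oplus> x \<otimes> y (Suc i))"
    using y(1) by blast
  fix y z :: "nat \<Rightarrow> 'a"
  assume "y \<in> UNIV \<rightarrow> carrier R \<and> (\<forall>i. y i = a i \<oplus> x \<otimes> y (Suc i))"
    and "z \<in> UNIV \<rightarrow> carrier R \<and> (\<forall>i. z i = a i \<oplus> x \<otimes> z (Suc i))"
  then have yz: "\<And>i. y i \<in> carrier R" "\<And>i. z i \<in> carrier R"
      "\<And>i. y i = a i \<oplus> x \<otimes> y (Suc i)" "\<And>i. z i = a i \<oplus> x \<otimes> z (Suc i)"
    by blast+
  have diff: "y i \<ominus> z i = x \<otimes> (y (Suc i) \<ominus> z (Suc i))" for i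
  proof -
    have "y i \<ominus> z i = (a i \<oplus> x \<otimes> y (Suc i)) \<ominus> (a i \<oplus> x \<otimes> z (Suc i))"
      using yz(3,4)[of i] by simp
    also have "\<dots> = x \<otimes> (y (Suc i) \<ominus> z (Suc i))"
      using yz(1,2)[of "Suc i"] a_carr[of i] x by algebra
    finally show ?thesis .
  qed
  have "y i \<ominus> z i \<in> ideal_power R I t" for i t
  proof (induction t arbitrary: i)
    case 0
    then show ?case using yz(1,2) by simp
  next
    case (Suc t)
    then show ?case using diff P_mult by metis
  qed
  then have "y i \<ominus> z i = \<zero>" for i
    using yz(1,2) by (intro adically_complete_separated[OF I complete]) auto
  then show "y = z" using yz(1,2) by (auto simp: fun_eq_iff)
qed

end

theorem theorem1p1:
  fixes R :: "('a, 'b) ring_scheme" and I :: "'a set"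
  assumes "cring R"
    and "finitely_generated_ideal R I"
    and "adically_complete R I"
    and "noetherian_ring (R Quot I)"
  shows "noetherian_ring R"
proof -
  interpret cring R by fact
  obtain A where A: "ideal I R" "finite A" "A \<subseteq> carrier R" "I = Idl\<^bsub>R\<^esub> A"
    using assms(2) unfolding finitely_generated_ideal_def by blast
  have "finitely_generated_ideal R J" if "ideal J R" for J
  proof (rule finitely_generated_drop_finite[OF A(2) _ _ _ that])
    show "shift_complete R x" if "x \<in> A" for x
      using that A genideal_self[OF A(3)]
      by (intro adically_complete_imp_shift_complete[OF A(1) assms(3)]) auto
    show "finitely_generated_ideal R K" if "ideal K R" "A \<subseteq> K" for K
      using that A(4) genideal_minimal
      by (intro finitely_generated_of_quotient[OF assms(2,4)]) auto
  qed (use A in auto)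
  then show ?thesis
    by (intro noetherian_ringI) (auto simp: finitely_generated_ideal_def)
qed

end
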